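(* Let $\Gamma$ be a finite undirected graph, and let $A_\Gamma^+$ be the associated right-angled Artin monoid. Then there exist an amenable (discrete) group $H$ and an injective monoid homomorphism $A_\Gamma^+\to H$; that is, $A_\Gamma^+$ can be embedded injectively as a submonoid of an amenable group.
   Context: For an undirected graph $\Gamma=(V,E)$ with vertex set $V=\{1,2,\dots,n\}$ and edge set $E$, the right-angled Artin monoid is the monoid given by the presentation $$A_\Gamma^+=\langle e_1,\dots,e_n : e_ie_j=e_je_i \text{ for all } ij\in E\rangle,$$ i.e. each vertex $i$ corresponds to a generator $e_i$, and the only defining relations are that $e_i$ and $e_j$ commute whenever $ij$ is an edge of $\Gamma$. *)

theory Defs
  imports "HOL-Algebra.Algebra" "Graph_Theory.Pair_Digraph"
begin

inductive pres_eq :: "'a set \<Rightarrow> ('a list \<times> 'a list) set \<Rightarrow> 'a list \<Rightarrow> 'a list \<Rightarrow> bool"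
  for S :: "'a set" and R :: "('a list \<times> 'a list) set"
where
  rel: "(u, v) \<in> R \<Longrightarrow> u \<in> lists S \<Longrightarrow> v \<in> lists S \<Longrightarrow> pres_eq S R u v"
| refl: "u \<in> lists S \<Longrightarrow> pres_eq S R u u"
| sym: "pres_eq S R u v \<Longrightarrow> pres_eq S R v u"
| trans: "pres_eq S R u v \<Longrightarrow> pres_eq S R v w \<Longrightarrow> pres_eq S R u w"
| mult: "pres_eq S R u v \<Longrightarrow> pres_eq S R u' v' \<Longrightarrow> pres_eq S R (u @ u') (v @ v')"

definition pres_cong :: "'a set \<Rightarrow> ('a list \<times> 'a list) set \<Rightarrow> ('a list \<times> 'a list) set" where
  "pres_cong S R = {(u, v). pres_eq S R u v}"

text \<open>The monoid with generators \<open>S\<close> and defining relations \<open>u = v\<close> for \<open>(u, v) \<in> R\<close>: the free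
  monoid of words over \<open>S\<close> modulo the congruence generated by \<open>R\<close>.\<close>

definition presented_monoid :: "'a set \<Rightarrow> ('a list \<times> 'a list) set \<Rightarrow> 'a list set monoid" where
  "presented_monoid S R =
     \<lparr>carrier = lists S // pres_cong S R,
      monoid.mult = (\<lambda>A B. \<Union>u\<in>A. \<Union>v\<in>B. pres_cong S R `` {u @ v}),
      monoid.one = pres_cong S R `` {[]}\<rparr>"

text \<open>An undirected graph is a symmetric digraph, so an edge \<open>ij\<close> is present as both arcs
  \<open>(i, j)\<close> and \<open>(j, i)\<close>.\<close>

definition raag_monoid :: "'v pair_pre_digraph \<Rightarrow> 'v list set monoid" where
  "raag_monoid \<Gamma> = presented_monoid (pverts \<Gamma>) {([i, j], [j, i]) | i j. (i, j) \<in> parcs \<Gamma>}"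

text \<open>Amenability as a discrete group: there is a finitely additive, left-invariant probability
  measure defined on all subsets. Amenability passes to subgroups and isomorphic copies, so a
  countable monoid embeds into some amenable group iff it embeds into one with carrier in
  \<open>nat\<close>.\<close>

definition amenable_group :: "('a, 'b) monoid_scheme \<Rightarrow> bool" where
  "amenable_group G \<longleftrightarrow> group G \<and>
     (\<exists>\<mu> :: 'a set \<Rightarrow> real.
        \<mu> (carrier G) = 1 \<and>
        (\<forall>A. A \<subseteq> carrier G \<longrightarrow> 0 \<le> \<mu> A) \<and>
        (\<forall>A B. A \<subseteq> carrier G \<longrightarrow> B \<subseteq> carrier G \<longrightarrow> A \<inter> B = {} \<longrightarrow> \<mu> (A \<union> B) = \<mu> A + \<mu> B) \<and>
        (\<forall>g A. g \<in> carrier G \<longrightarrow> A \<subseteq> carrier G \<longrightarrow> \<mu> (g <#\<^bsub>G\<^esub> A) = \<mu> A))"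

text \<open>The constant \<open>hom\<close> only asks for multiplicativity; a monoid homomorphism also preserves the
  unit.\<close>

definition monoid_embedding ::
    "('a, 'c) monoid_scheme \<Rightarrow> ('b, 'd) monoid_scheme \<Rightarrow> ('a \<Rightarrow> 'b) \<Rightarrow> bool" where
  "monoid_embedding M N h \<longleftrightarrow>
     h \<in> hom M N \<and> h \<one>\<^bsub>M\<^esub> = \<one>\<^bsub>N\<^esub> \<and> inj_on h (carrier M)"

lemma pres_eq_lists: "pres_eq S R u v \<Longrightarrow> u \<in> lists S \<and> v \<in> lists S"
  by (induction rule: pres_eq.induct) auto

lemma equiv_pres_cong: "equiv (lists S) (pres_cong S R)"
proof (rule equivI)
  show "pres_cong S R \<subseteq> lists S \<times> lists S"
    unfolding pres_cong_def using pres_eq_lists by blast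
  show "refl_on (lists S) (pres_cong S R)"
    unfolding refl_on_def pres_cong_def by (blast intro: pres_eq.refl)
  show "sym_on UNIV (pres_cong S R)"
    unfolding sym_def pres_cong_def by (blast intro: pres_eq.sym)
  show "trans_on UNIV (pres_cong S R)"
    unfolding trans_def pres_cong_def by (blast intro: pres_eq.trans)
qed

lemma presented_monoid_mult:
  assumes "u \<in> lists S" "v \<in> lists S"
  shows "(pres_cong S R `` {u}) \<otimes>\<^bsub>presented_monoid S R\<^esub> (pres_cong S R `` {v})
         = pres_cong S R `` {u @ v}"
proof -
  have "congruent2 (pres_cong S R) (pres_cong S R) (\<lambda>u v. pres_cong S R `` {u @ v})"
    unfolding congruent2_def pres_cong_def
    by (auto; meson pres_eq.mult pres_eq.sym pres_eq.trans)
  from UN_equiv_class2[OF equiv_pres_cong equiv_pres_cong this assms]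
  show ?thesis by (simp add: presented_monoid_def)
qed

lemma monoid_presented_monoid: "monoid (presented_monoid S R)"
proof (rule monoidI)
  let ?M = "presented_monoid S R" and ?c = "\<lambda>u. pres_cong S R `` {u}"
  have car: "carrier ?M = ?c ` lists S"
    by (auto simp: presented_monoid_def quotient_def)
  have one: "\<one>\<^bsub>?M\<^esub> = ?c []" by (simp add: presented_monoid_def)
  note m = presented_monoid_mult[of _ S _ R]
  show "\<one>\<^bsub>?M\<^esub> \<in> carrier ?M" unfolding car one by blast
  fix x y z
  assume "x \<in> carrier ?M" "y \<in> carrier ?M" "z \<in> carrier ?M"
  then obtain u v w where uvw: "u \<in> lists S" "v \<in> lists S" "w \<in> lists S"
    and x: "x = ?c u" and y: "y = ?c v" and z: "z = ?c w"
    unfolding car by blast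
  from uvw have app: "u @ v \<in> lists S" "v @ w \<in> lists S" "[] \<in> lists S" by auto
  show "x \<otimes>\<^bsub>?M\<^esub> y \<in> carrier ?M" unfolding x y m[OF uvw(1,2)] car using app by blast
  show "x \<otimes>\<^bsub>?M\<^esub> y \<otimes>\<^bsub>?M\<^esub> z = x \<otimes>\<^bsub>?M\<^esub> (y \<otimes>\<^bsub>?M\<^esub> z)"
    unfolding x y z m[OF uvw(1,2)] m[OF uvw(2,3)] m[OF app(1) uvw(3)] m[OF uvw(1) app(2)]
    by simp
next
  fix x assume "x \<in> carrier (presented_monoid S R)"
  then obtain u where u: "u \<in> lists S" and x: "x = pres_cong S R `` {u}"
    by (auto simp: presented_monoid_def quotient_def)
  have one: "\<one>\<^bsub>presented_monoid S R\<^esub> = pres_cong S R `` {[]}"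
    by (simp add: presented_monoid_def)
  show "\<one>\<^bsub>presented_monoid S R\<^esub> \<otimes>\<^bsub>presented_monoid S R\<^esub> x = x"
    unfolding x one using presented_monoid_mult[of "[]" S u R] u by simp
  show "x \<otimes>\<^bsub>presented_monoid S R\<^esub> \<one>\<^bsub>presented_monoid S R\<^esub> = x"
    unfolding x one using presented_monoid_mult[of u S "[]" R] u by simp
qed

end

theory Submission
  imports Defs "HOL-Analysis.Function_Topology" "HOL-Analysis.Finite_Cartesian_Product"
begin

text \<open>
  Three facts carry the proof.

  First, a trace of the partially commutative monoid is determined by its projections onto pairs of
  letters that do not commute (a letter being paired with itself as well): two words that agree
  under all these projections can be transformed into one another by commutations
  (\<open>eq_if_proj_eq\<close>).  A projection onto two letters is a word over a two-letter alphabet, so the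
  monoid embeds into a finite power of the free monoid on two generators.

  Second, the free monoid on two generators lives inside a solvable group: the affine maps
  \<open>x \<mapsto> 2 x\<close> and \<open>x \<mapsto> 2 x + 1\<close> of the rational line generate it freely, because a composition of
  such maps records the length and the value of a binary numeral (\<open>inj_binary_affine\<close>).  Affine maps
  with linear part a power of two form a metabelian group, and so does any power of this group.

  Third, solvable groups are amenable (\<open>solvable_imp_amenable\<close>).  Climbing along a normal
  series with abelian quotients, a mean invariant under a normal subgroup is averaged over the powers
  of one further element at a time: invariance under everything gained before survives, since
  commutators lie in the subgroup, and invariance under the new element holds up to an error that
  tends to zero.  Compactness of the space of means removes the error and passes from finitely many
  new elements to all of them.  Finally, a finite power of a countable group is countable, so the
  group can be moved onto the natural numbers.
\<close>

section \<open>Amenability of solvable groups\<close>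


text \<open>The values on all sets are confined to the unit interval, including those on sets outside the
  carrier that no other condition constrains; this makes the set of means compact.\<close>

definition means :: "('a, 'b) monoid_scheme \<Rightarrow> ('a set \<Rightarrow> real) set" where
  "means G = {\<mu>. (\<forall>A. \<mu> A \<in> {0..1}) \<and> \<mu> (carrier G) = 1 \<and>
     (\<forall>A B. A \<subseteq> carrier G \<longrightarrow> B \<subseteq> carrier G \<longrightarrow> A \<inter> B = {} \<longrightarrow> \<mu> (A \<union> B) = \<mu> A + \<mu> B)}"

definition almost_inv :: "('a, 'b) monoid_scheme \<Rightarrow> real \<Rightarrow> 'a \<Rightarrow> ('a set \<Rightarrow> real) set" where
  "almost_inv G \<epsilon> g = {\<mu>. \<forall>A. A \<subseteq> carrier G \<longrightarrow> \<bar>\<mu> (g <#\<^bsub>G\<^esub> A) - \<mu> A\<bar> \<le> \<epsilon>}"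

definition inv_means :: "('a, 'b) monoid_scheme \<Rightarrow> 'a set \<Rightarrow> ('a set \<Rightarrow> real) set" where
  "inv_means G T = means G \<inter> \<Inter> (almost_inv G 0 ` T)"

lemma inv_meansD: "\<mu> \<in> inv_means G T \<Longrightarrow> g \<in> T \<Longrightarrow> A \<subseteq> carrier G \<Longrightarrow> \<mu> (g <#\<^bsub>G\<^esub> A) = \<mu> A"
  by (force simp: inv_means_def almost_inv_def)

lemma inv_meansI:
  assumes "\<mu> \<in> means G" "\<And>g A. g \<in> T \<Longrightarrow> A \<subseteq> carrier G \<Longrightarrow> \<mu> (g <#\<^bsub>G\<^esub> A) = \<mu> A"
  shows "\<mu> \<in> inv_means G T"
  using assms by (auto simp: inv_means_def almost_inv_def)

lemma closed_almost_inv: "closed (almost_inv G \<epsilon> g)"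
proof -
  have "almost_inv G \<epsilon> g = (\<Inter>A\<in>Pow (carrier G). {\<mu>. \<bar>\<mu> (g <#\<^bsub>G\<^esub> A) - \<mu> A\<bar> \<le> \<epsilon>})"
    by (auto simp: almost_inv_def)
  also have "closed \<dots>"
    by (intro closed_INT ballI closed_Collect_le continuous_intros continuous_on_product_coordinates)
  finally show ?thesis .
qed

text \<open>By Tychonoff's theorem the cube of all functions from sets to the unit interval is compact, and
  each condition on a mean relates only finitely many coordinates, so that it is closed.\<close>

lemma compact_means: "compact (means G)"
proof -
  let ?box = "PiE UNIV (\<lambda>_. {0..1}) :: ('a set \<Rightarrow> real) set"
  have "compact ?box"
    using compactin_PiE[of "\<lambda>_. euclidean" UNIV "\<lambda>_::'a set. {0..1::real}"]
    unfolding euclidean_product_topology by simp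
  moreover have "means G = ?box \<inter> ({\<mu>. \<mu> (carrier G) = 1} \<inter>
      (\<Inter>A\<in>Pow (carrier G). \<Inter>B\<in>{B \<in> Pow (carrier G). A \<inter> B = {}}. {\<mu>. \<mu> (A \<union> B) = \<mu> A + \<mu> B}))"
    (is "_ = _ \<inter> ?C") unfolding means_def by (auto simp: PiE_def Pi_def)
  moreover have "closed ?C"
    by (intro closed_INT closed_Int ballI closed_Collect_eq continuous_intros
        continuous_on_product_coordinates)
  ultimately show ?thesis by (simp add: compact_Int_closed)
qed

lemma compact_inv_means: "compact (inv_means G T)"
  unfolding inv_means_def by (intro compact_Int_closed compact_means closed_INT ballI closed_almost_inv)

text \<open>The two uses of compactness: invariance under infinitely many elements may be established for
  finitely many at a time, and exact invariance may be established up to arbitrarily small errors.\<close>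

lemma inv_means_nonempty_if_finite:
  assumes "\<And>S. finite S \<Longrightarrow> S \<subseteq> T \<Longrightarrow> inv_means G (N \<union> S) \<noteq> {}"
  shows "inv_means G (N \<union> T) \<noteq> {}"
proof -
  have eq: "inv_means G (N \<union> S) = inv_means G N \<inter> \<Inter> (almost_inv G 0 ` S)" for S
    by (auto simp: inv_means_def)
  show ?thesis unfolding eq
    by (rule compact_imp_fip_image[OF compact_inv_means closed_almost_inv])
      (use assms in \<open>simp add: eq\<close>)
qed

lemma inv_means_nonempty_if_almost:
  assumes "\<And>n. inv_means G T \<inter> almost_inv G (1 / real (Suc n)) g \<noteq> {}"
  shows "inv_means G (insert g T) \<noteq> {}"
proof -
  let ?C = "\<lambda>n. almost_inv G (1 / real (Suc n)) g"
  have "inv_means G T \<inter> (\<Inter>n. ?C n) \<noteq> {}"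
  proof (rule compact_imp_fip_image[OF compact_inv_means closed_almost_inv])
    fix I :: "nat set" assume "finite I"
    then obtain m where m: "\<forall>n\<in>I. n \<le> m" using finite_nat_set_iff_bounded_le by blast
    \<comment> \<open>The conditions are nested, so the strongest of finitely many implies the others.\<close>
    have "?C m \<subseteq> ?C n" if "n \<in> I" for n
    proof -
      have "1 / real (Suc m) \<le> 1 / real (Suc n)"
        using m that by (intro divide_left_mono) auto
      then show ?thesis unfolding almost_inv_def by force
    qed
    then show "inv_means G T \<inter> \<Inter> (?C ` I) \<noteq> {}" using assms[of m] by blast
  qed
  then obtain \<mu> where \<mu>: "\<mu> \<in> inv_means G T" "\<And>n. \<mu> \<in> ?C n" by blast
  have "\<mu> \<in> almost_inv G 0 g"
    unfolding almost_inv_def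
  proof (intro CollectI allI impI)
    fix A assume "A \<subseteq> carrier G"
    with \<mu>(2) have *: "\<bar>\<mu> (g <#\<^bsub>G\<^esub> A) - \<mu> A\<bar> \<le> 1 / real (Suc n)" for n
      unfolding almost_inv_def by blast
    show "\<bar>\<mu> (g <#\<^bsub>G\<^esub> A) - \<mu> A\<bar> \<le> 0"
      by (rule ccontr) (metis * inverse_eq_divide not_le reals_Archimedean)
  qed
  with \<mu>(1) show ?thesis by (auto simp: inv_means_def)
qed

context group begin

text \<open>The witness is the average of the translates of \<open>\<mu>\<close> by \<open>g\<^sup>0, \<dots>, g\<^sup>n\<close>.  Translating it by
  \<open>g\<close> replaces one summand by another, an error of at most \<open>1 / (n + 1)\<close>.  It stays
  \<open>T\<close>-invariant because a power of \<open>g\<close> moves past \<open>s \<in> T\<close> at the price of a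
  commutator, under which \<open>\<mu>\<close> is invariant.\<close>

lemma average_along_powers:
  assumes \<mu>: "\<mu> \<in> inv_means G T" and T: "T \<subseteq> carrier G" and g: "g \<in> carrier G"
    and comm: "\<And>s k. s \<in> T \<Longrightarrow> inv s \<otimes> g [^] k \<otimes> s \<otimes> inv (g [^] (k::nat)) \<in> T"
  shows "inv_means G T \<inter> almost_inv G (1 / real (Suc n)) g \<noteq> {}"
proof -
  define \<nu> where "\<nu> A = (\<Sum>k<Suc n. \<mu> ((g [^] k) <# A)) / real (Suc n)" for A
  have bd: "0 \<le> \<mu> A" "\<mu> A \<le> 1" for A
    using \<mu> by (auto simp: inv_means_def means_def)
  have gk: "g [^] k \<in> carrier G" for k :: nat using g by simp
  have "\<nu> \<in> means G"
    unfolding means_def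
  proof (intro CollectI conjI allI impI)
    fix A
    have "(\<Sum>k<Suc n. \<mu> ((g [^] k) <# A)) \<le> (\<Sum>k<Suc n. 1)"
      by (intro sum_mono bd)
    moreover have "0 \<le> (\<Sum>k<Suc n. \<mu> ((g [^] k) <# A))"
      by (intro sum_nonneg bd)
    ultimately show "\<nu> A \<in> {0..1}" by (simp add: \<nu>_def)
  next
    have "(g [^] k) <# carrier G = carrier G" for k :: nat
      using coset_join3[OF gk subgroup_self gk] .
    moreover have "\<mu> (carrier G) = 1" using \<mu> by (auto simp: inv_means_def means_def)
    ultimately show "\<nu> (carrier G) = 1" by (simp add: \<nu>_def)
  next
    fix A B assume AB: "A \<subseteq> carrier G" "B \<subseteq> carrier G" "A \<inter> B = {}"
    have "\<mu> ((g [^] k) <# (A \<union> B)) = \<mu> ((g [^] k) <# A) + \<mu> ((g [^] k) <# B)" for k :: nat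
    proof -
      have "(g [^] k) <# (A \<union> B) = ((g [^] k) <# A) \<union> ((g [^] k) <# B)" by (auto simp: l_coset_def)
      moreover have "((g [^] k) <# A) \<inter> ((g [^] k) <# B) = {}"
        using AB gk[of k] by (auto simp: l_coset_def subset_iff disjoint_iff)
      ultimately show ?thesis
        using \<mu> AB l_coset_subset_G gk[of k] by (auto simp: inv_means_def means_def)
    qed
    then show "\<nu> (A \<union> B) = \<nu> A + \<nu> B"
      by (simp add: \<nu>_def sum.distrib add_divide_distrib del: sum.lessThan_Suc)
  qed
  moreover have "\<nu> (s <# A) = \<nu> A" if s: "s \<in> T" and A: "A \<subseteq> carrier G" for s A
  proof -
    have "\<mu> ((g [^] k) <# (s <# A)) = \<mu> ((g [^] k) <# A)" for k :: nat
    proof -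
      let ?x = "g [^] k" and ?c = "inv s \<otimes> g [^] k \<otimes> s \<otimes> inv (g [^] k)"
      have sc: "s \<in> carrier G" and cT: "?c \<in> T" and cc: "?c \<in> carrier G"
        using s T comm by auto
      have xs: "?x \<otimes> s = s \<otimes> (?c \<otimes> ?x)"
        using sc gk[of k] by (simp add: m_assoc flip: m_assoc[of s "inv s"])
      have "?x <# (s <# A) = (?x \<otimes> s) <# A"
        using sc gk[of k] A by (simp only: lcos_m_assoc)
      also have "\<dots> = s <# ((?c \<otimes> ?x) <# A)"
        unfolding xs using sc gk[of k] cc A by (simp only: lcos_m_assoc m_closed)
      also have "\<dots> = s <# (?c <# (?x <# A))"
        using gk[of k] cc A by (simp only: lcos_m_assoc)
      finally have "?x <# (s <# A) = s <# (?c <# (?x <# A))" .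
      then show ?thesis
        using inv_meansD[OF \<mu>] s cT A gk[of k] cc by (simp add: l_coset_subset_G)
    qed
    then show ?thesis by (simp add: \<nu>_def)
  qed
  moreover have "\<bar>\<nu> (g <# A) - \<nu> A\<bar> \<le> 1 / real (Suc n)" if A: "A \<subseteq> carrier G" for A
  proof -
    have "\<nu> (g <# A) - \<nu> A = (\<Sum>k<Suc n. \<mu> ((g [^] Suc k) <# A) - \<mu> ((g [^] k) <# A)) / real (Suc n)"
      using A g by (simp add: \<nu>_def lcos_m_assoc sum_subtractf diff_divide_distrib del: sum.lessThan_Suc)
    also have "\<dots> = (\<mu> ((g [^] Suc n) <# A) - \<mu> ((g [^] (0::nat)) <# A)) / real (Suc n)"
      by (simp only: sum_lessThan_telescope[of "\<lambda>k. \<mu> ((g [^] k) <# A)"])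
    finally show ?thesis
      using bd[of "(g [^] Suc n) <# A"] bd[of "(g [^] (0::nat)) <# A"]
      by (simp add: abs_le_iff divide_right_mono del: nat_pow_Suc nat_pow_0)
  qed
  ultimately have "\<nu> \<in> inv_means G T \<inter> almost_inv G (1 / real (Suc n)) g"
    by (auto intro: inv_meansI simp: almost_inv_def)
  then show ?thesis by blast
qed

text \<open>Elements of \<open>H\<close> are adjoined to \<open>N\<close> one by one.  Intermediate sets are no
  subgroups in general, yet averaging applies: all commutators that arise lie in \<open>N\<close> already.\<close>

lemma inv_means_abelian_extension:
  assumes H: "subgroup H G" and NH: "N \<subseteq> H" and comm: "derived G H \<subseteq> N"
    and N: "inv_means G N \<noteq> {}"
  shows "inv_means G H \<noteq> {}"
proof -
  note Hc = subgroup.subset[OF H]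
  have "inv_means G (N \<union> S) \<noteq> {}" if "finite S" "S \<subseteq> H" for S
    using that
  proof (induction S)
    case empty
    then show ?case using N by simp
  next
    case (insert g S)
    then obtain \<mu> where \<mu>: "\<mu> \<in> inv_means G (N \<union> S)" by blast
    have gH: "g \<in> H" and SH: "N \<union> S \<subseteq> H" using insert.prems NH by auto
    have "inv s \<otimes> g [^] k \<otimes> s \<otimes> inv (g [^] k) \<in> N \<union> S" if "s \<in> N \<union> S" for s and k :: nat
    proof -
      have s: "s \<in> H" "s \<in> carrier G" using that SH Hc by auto
      have x: "g [^] k \<in> H"
        using gH by (induction k) (auto intro: subgroup.m_closed[OF H] subgroup.one_closed[OF H])
      have "inv s \<otimes> g [^] k \<otimes> inv (inv s) \<otimes> inv (g [^] k) \<in> derived G H"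
        unfolding derived_def
        by (rule generate.incl) (use subgroup.m_inv_closed[OF H s(1)] x in blast)
      then show ?thesis using comm s by auto
    qed
    then have "inv_means G (insert g (N \<union> S)) \<noteq> {}"
      using SH Hc gH
      by (intro inv_means_nonempty_if_almost average_along_powers[OF \<mu>]) auto
    then show ?case by simp
  qed
  then have "inv_means G (N \<union> H) \<noteq> {}" by (rule inv_means_nonempty_if_finite)
  with NH show ?thesis by (simp add: Un_absorb1)
qed

text \<open>The induction starts from the point mass at the unit, which the trivial subgroup fixes.\<close>

theorem solvable_imp_amenable:
  assumes "solvable G"
  shows "amenable_group G"
proof -
  have "inv_means G H \<noteq> {}" if "solvable_seq G H" for H
    using that
  proof (induction)
    case unity
    have "(\<lambda>A. of_bool (\<one> \<in> A)) \<in> inv_means G {\<one>}"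
      by (rule inv_meansI) (auto simp: means_def lcos_mult_one)
    then show ?case by blast
  next
    case (extension K H)
    have "K \<subseteq> H" using subgroup.subset[OF normal.axioms(1)[OF extension.hyps(2)]] by simp
    moreover have "derived G H \<subseteq> K"
      using derived_of_subgroup_minimal extension.hyps by blast
    ultimately show ?case
      using inv_means_abelian_extension extension by blast
  qed
  with assms obtain \<mu> where \<mu>: "\<mu> \<in> inv_means G (carrier G)"
    unfolding solvable_def by blast
  then have "\<mu> \<in> means G" by (simp add: inv_means_def)
  then show ?thesis
    unfolding amenable_group_def using inv_meansD[OF \<mu>]
    by (intro conjI is_group exI[of _ \<mu>]) (auto simp: means_def)
qed

end


section \<open>Metabelian groups and countable copies\<close>


lemma (in group) solvable_if_commutators_commute:
  assumes A: "subgroup A G"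
    and comm: "\<And>x y. x \<in> carrier G \<Longrightarrow> y \<in> carrier G \<Longrightarrow> x \<otimes> y \<otimes> inv x \<otimes> inv y \<in> A"
    and abel: "\<And>x y. x \<in> A \<Longrightarrow> y \<in> A \<Longrightarrow> x \<otimes> y = y \<otimes> x"
  shows "solvable G"
proof -
  have "derived G (carrier G) \<subseteq> A"
    unfolding derived_def using comm by (intro generate_subgroup_incl[OF _ A]) auto
  then have "derived G (derived G (carrier G)) \<subseteq> derived G A"
    by (rule mono_derived)
  also have "derived G A \<subseteq> {\<one>}"
    unfolding derived_def
  proof (rule generate_subgroup_incl)
    have "x \<otimes> y \<otimes> inv x \<otimes> inv y = \<one>" if "x \<in> A" "y \<in> A" for x y
      using abel[OF that] that subgroup.subset[OF A]
      by (auto simp: subset_iff m_assoc)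
    then show "derived_set G A \<subseteq> {\<one>}" by auto
  qed (rule triv_subgroup)
  finally have "(derived G ^^ 2) (carrier G) \<subseteq> {\<one>}" by (simp add: numeral_2_eq_2)
  moreover have "\<one> \<in> (derived G ^^ 2) (carrier G)"
    using subgroup.one_closed[OF exp_of_derived_is_subgroup[OF subgroup_self]] .
  ultimately show ?thesis using solvable_iff_trivial_derived_seq by blast
qed

lemma countable_solvable_group_nat_copy:
  assumes "group G" "solvable G" "countable (carrier G)"
  shows "\<exists>(H :: nat monoid) f. group H \<and> solvable H \<and> monoid_embedding G H f"
proof -
  let ?f = "to_nat_on (carrier G)"
  let ?H = "image_group ?f G"
  have inj: "inj_on ?f (carrier G)" using assms(3) by (rule inj_on_to_nat_on)
  have H: "group ?H" using group.inj_imp_image_group_is_group[OF assms(1) inj] .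
  have iso: "?f \<in> iso G ?H" using inj_imp_image_group_iso[OF inj] .
  then have hom: "group_hom G ?H ?f"
    using assms(1) H by (simp add: group_hom_def group_hom_axioms_def iso_def)
  have "solvable ?H"
    using group_hom.surj_hom_imp_solvable[OF hom _ assms(2)] by (simp add: image_group_carrier)
  with H inj hom show ?thesis
    unfolding monoid_embedding_def
    by (intro exI[of _ ?H] exI[of _ ?f]) (auto simp: group_hom.hom_one group_hom.homh)
qed

lemma monoid_embedding_trans:
  assumes "monoid_embedding L M f" "monoid_embedding M N g"
  shows "monoid_embedding L N (g \<circ> f)"
  using assms by (auto simp: monoid_embedding_def hom_def Pi_def comp_inj_on_iff inj_on_def)

section \<open>A free monoid inside the affine group\<close>

text \<open>The pair \<open>(b, k)\<close> stands for the map \<open>x \<mapsto> 2\<^sup>k x + b\<close>, and multiplication is composition.\<close>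

definition affine_group :: "(rat \<times> int) monoid" where
  "affine_group = \<lparr>carrier = UNIV, monoid.mult = (\<lambda>(b, k) (c, m). (b + 2 powi k * c, k + m)),
     one = (0, 0)\<rparr>"

lemma affine_group_simps [simp]:
  "carrier affine_group = UNIV"
  "(b, k) \<otimes>\<^bsub>affine_group\<^esub> (c, m) = (b + 2 powi k * c, k + m)"
  "\<one>\<^bsub>affine_group\<^esub> = (0, 0)"
  by (simp_all add: affine_group_def)

lemma group_affine_group: "group affine_group"
proof (rule groupI)
  fix x y z :: "rat \<times> int"
  show "x \<otimes>\<^bsub>affine_group\<^esub> y \<otimes>\<^bsub>affine_group\<^esub> z = x \<otimes>\<^bsub>affine_group\<^esub> (y \<otimes>\<^bsub>affine_group\<^esub> z)"
    by (cases x; cases y; cases z) (simp add: power_int_add algebra_simps)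
next
  fix x :: "rat \<times> int"
  show "\<exists>y\<in>carrier affine_group. y \<otimes>\<^bsub>affine_group\<^esub> x = \<one>\<^bsub>affine_group\<^esub>"
    by (cases x) (auto intro!: exI[of _ "- (2 powi (- snd x) * fst x)"] exI[of _ "- snd x"])
qed auto

lemma snd_mult_affine [simp]: "snd (x \<otimes>\<^bsub>affine_group\<^esub> y) = snd x + snd y"
  by (cases x; cases y) simp

lemma snd_inv_affine [simp]: "snd (inv\<^bsub>affine_group\<^esub> x) = - snd x"
proof -
  have "snd (inv\<^bsub>affine_group\<^esub> x \<otimes>\<^bsub>affine_group\<^esub> x) = 0"
    by (subst group.l_inv[OF group_affine_group]) auto
  then show ?thesis by (simp del: affine_group_simps(2))
qed

lemma translations_commute:
  "snd x = 0 \<Longrightarrow> snd y = 0 \<Longrightarrow> x \<otimes>\<^bsub>affine_group\<^esub> y = y \<otimes>\<^bsub>affine_group\<^esub> x"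
  by (cases x; cases y) simp

text \<open>Translations form an abelian subgroup that contains all commutators, as the linear parts commute.
  Both properties are checked coordinatewise, hence hold in every power.\<close>

lemma solvable_affine_power: "solvable (product_group (I :: 'a set) (\<lambda>_. affine_group))" (is "solvable ?P")
proof -
  let ?A = "\<Pi>\<^sub>E i\<in>I. {x :: rat \<times> int. snd x = 0}"
  have grp: "group ?P" by (simp add: group_affine_group)
  have "subgroup {x. snd x = 0} affine_group"
    by (rule group.subgroupI[OF group_affine_group]) auto
  then have "subgroup ?A ?P"
    by (subst PiE_subgroup_product_group) (auto simp: group_affine_group)
  then show ?thesis
  proof (rule group.solvable_if_commutators_commute[OF grp])
    fix x y :: "'a \<Rightarrow> rat \<times> int" assume "x \<in> carrier ?P" "y \<in> carrier ?P"
    then show "x \<otimes>\<^bsub>?P\<^esub> y \<otimes>\<^bsub>?P\<^esub> inv\<^bsub>?P\<^esub> x \<otimes>\<^bsub>?P\<^esub> inv\<^bsub>?P\<^esub> y \<in> ?A"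
      by (simp add: group_affine_group PiE_iff)
  next
    fix x y assume "x \<in> ?A" "y \<in> ?A"
    then show "x \<otimes>\<^bsub>?P\<^esub> y = y \<otimes>\<^bsub>?P\<^esub> x"
      by (auto intro!: restrict_ext translations_commute)
  qed
qed

text \<open>The image of a word under the homomorphism sending \<open>False\<close> to \<open>x \<mapsto> 2 x\<close> and \<open>True\<close> to
  \<open>x \<mapsto> 2 x + 1\<close>: the translation part is the value of the binary numeral whose first bit is
  the least significant one.\<close>

definition binary_affine :: "bool list \<Rightarrow> rat \<times> int" where
  "binary_affine bs = (horner_sum of_bool 2 bs, int (length bs))"

lemma binary_affine_Nil: "binary_affine [] = \<one>\<^bsub>affine_group\<^esub>"
  by (simp add: binary_affine_def)

lemma binary_affine_append:
  "binary_affine (bs @ cs) = binary_affine bs \<otimes>\<^bsub>affine_group\<^esub> binary_affine cs"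
  by (simp add: binary_affine_def horner_sum_append)

text \<open>The exponent gives the number of bits, without which leading zeros of the numeral would be lost;
  the parity of the value then reveals the bits one after another.\<close>

lemma inj_binary_affine: "inj binary_affine"
proof (rule injI)
  fix bs cs assume eq: "binary_affine bs = binary_affine cs"
  then have "length bs = length cs" by (simp add: binary_affine_def)
  moreover have hs: "of_int (horner_sum of_bool 2 xs) = (horner_sum of_bool 2 xs :: rat)" for xs
    by (induction xs) auto
  have "(horner_sum of_bool 2 bs :: int) = horner_sum of_bool 2 cs"
    using eq hs[of bs] hs[of cs] by (simp add: binary_affine_def)
  ultimately show "bs = cs"
  proof (induction bs cs rule: list_induct2)
    case (Cons b bs c cs)
    \<comment> \<open>The values are \<open>of_bool b + 2 * _\<close> and \<open>of_bool c + 2 * _\<close>.\<close>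
    have "b = c"
      using arg_cong[OF Cons.prems, of even] by (cases b; cases c) auto
    with Cons show ?case by simp
  qed simp
qed

section \<open>Traces are determined by their projections\<close>

definition proj :: "'v \<times> 'v \<Rightarrow> 'v list \<Rightarrow> 'v list" where
  "proj p = filter (\<lambda>x. x = fst p \<or> x = snd p)"

locale trace_monoid =
  fixes V :: "'v set" and E :: "('v \<times> 'v) set"
  assumes sym_E: "sym E"
begin

abbreviation rels :: "('v list \<times> 'v list) set" where
  "rels \<equiv> {([i, j], [j, i]) | i j. (i, j) \<in> E}"

text \<open>The diagonal is included, also at vertices with a loop: the projection to \<open>(i, i)\<close> counts the
  occurrences of \<open>i\<close>, which matters for a letter that commutes with all others.\<close>

definition non_edges :: "('v \<times> 'v) set" where
  "non_edges = {(i, j) \<in> V \<times> V. i = j \<or> (i, j) \<notin> E}"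

lemma proj_cong:
  assumes "pres_eq V rels u v" and p: "p \<in> non_edges"
  shows "proj p u = proj p v"
  using assms(1)
proof induction
  case (rel u v)
  then show ?case using p symD[OF sym_E]
    by (auto simp: proj_def non_edges_def)
qed (auto simp: proj_def)

lemma move_to_front:
  assumes "\<forall>x\<in>set w. (x, a) \<in> E" "w \<in> lists V" "a \<in> V"
  shows "pres_eq V rels (w @ [a]) (a # w)"
  using assms
proof (induction w)
  case Nil
  then show ?case by (auto intro: pres_eq.refl)
next
  case (Cons x w)
  have "pres_eq V rels ([x] @ (w @ [a])) ([x] @ (a # w))"
    using Cons by (intro pres_eq.mult pres_eq.refl) auto
  moreover have "pres_eq V rels ([x, a] @ w) ([a, x] @ w)"
    using Cons.prems by (intro pres_eq.mult pres_eq.rel pres_eq.refl) auto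
  ultimately show ?case by (auto intro: pres_eq.trans)
qed

text \<open>Induction on \<open>u\<close>.  Let \<open>a\<close> be its first letter, which then occurs in \<open>v\<close> too.  A letter in front
  of the first \<open>a\<close> in \<open>v\<close> that does not commute with \<open>a\<close> would start the projection of \<open>v\<close> to this pair
  of letters with something other than \<open>a\<close>, unlike that of \<open>u\<close>.  So \<open>a\<close> can be moved to the front of
  \<open>v\<close> and cancelled on both sides.\<close>

lemma eq_if_proj_eq:
  assumes "u \<in> lists V" "v \<in> lists V" "\<And>p. p \<in> non_edges \<Longrightarrow> proj p u = proj p v"
  shows "pres_eq V rels u v"
  using assms
proof (induction u arbitrary: v rule: list.induct)
  case Nil
  have "v = []"
  proof (cases v)
    case (Cons x w)
    then have "(x, x) \<in> non_edges" using \<open>v \<in> lists V\<close> by (simp add: non_edges_def)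
    then have "proj (x, x) [] = proj (x, x) v" by (rule Nil.prems)
    then show ?thesis by (simp add: proj_def Cons)
  qed
  then show ?case by (simp add: pres_eq.refl)
next
  case (Cons a u)
  have a: "a \<in> V" and u: "u \<in> lists V" using Cons.prems by auto
  have "(a, a) \<in> non_edges" using a by (simp add: non_edges_def)
  from Cons.prems(3)[OF this] have "a \<in> set (proj (a, a) v)"
    by (metis (mono_tags) filter.simps(2) fst_conv list.set_intros(1) proj_def)
  then have "a \<in> set v" by (simp add: proj_def)
  then obtain v1 v2 where v: "v = v1 @ a # v2" and a1: "a \<notin> set v1"
    by (meson split_list_first)
  have vV: "v1 \<in> lists V" "v2 \<in> lists V" using Cons.prems(2) v by auto
  have "(x, a) \<in> E" if x: "x \<in> set v1" for x
  proof (rule ccontr)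
    assume "(x, a) \<notin> E"
    then have "(x, a) \<in> non_edges" using x vV a by (auto simp: non_edges_def in_lists_conv_set)
    from Cons.prems(3)[OF this]
    have "a # proj (x, a) u = proj (x, a) v1 @ a # proj (x, a) v2"
      by (simp add: proj_def v)
    moreover have "proj (x, a) v1 \<noteq> []" using x by (auto simp: proj_def filter_empty_conv)
    ultimately have "a \<in> set (proj (x, a) v1)"
      by (metis append_eq_Cons_conv list.set_intros(1))
    then show False using a1 by (simp add: proj_def)
  qed
  then have front: "pres_eq V rels (v1 @ [a]) (a # v1)"
    using vV a by (intro move_to_front) auto
  have "pres_eq V rels ((v1 @ [a]) @ v2) ((a # v1) @ v2)"
    using front vV by (intro pres_eq.mult pres_eq.refl)
  then have v_eq: "pres_eq V rels v (a # v1 @ v2)" by (simp add: v)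
  have "pres_eq V rels u (v1 @ v2)"
  proof (rule Cons.IH)
    fix p assume p: "p \<in> non_edges"
    have "proj p (a # u) = proj p (a # v1 @ v2)"
      using Cons.prems(3)[OF p] proj_cong[OF v_eq p] by simp
    then show "proj p u = proj p (v1 @ v2)" by (auto simp: proj_def split: if_splits)
  qed (use u vV in auto)
  then have "pres_eq V rels ([a] @ u) ([a] @ (v1 @ v2))"
    using a by (intro pres_eq.mult pres_eq.refl) auto
  then show ?case using v_eq by (auto intro: pres_eq.trans pres_eq.sym)
qed

end

section \<open>The embedding\<close>

lemma presented_monoid_embedding:
  assumes one: "\<Phi> [] = \<one>\<^bsub>M\<^esub>"
    and closed: "\<And>u. u \<in> lists S \<Longrightarrow> \<Phi> u \<in> carrier M"
    and mult: "\<And>u v. u \<in> lists S \<Longrightarrow> v \<in> lists S \<Longrightarrow> \<Phi> (u @ v) = \<Phi> u \<otimes>\<^bsub>M\<^esub> \<Phi> v"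
    and eq: "\<And>u v. u \<in> lists S \<Longrightarrow> v \<in> lists S \<Longrightarrow> \<Phi> u = \<Phi> v \<longleftrightarrow> pres_eq S R u v"
  shows "\<exists>h. monoid_embedding (presented_monoid S R) M h"
proof -
  let ?c = "\<lambda>u. pres_cong S R `` {u}"
  define h where "h A = \<Phi> (SOME u. u \<in> A)" for A
  have car: "carrier (presented_monoid S R) = ?c ` lists S"
    by (auto simp: presented_monoid_def quotient_def)
  have h: "h (?c u) = \<Phi> u" if u: "u \<in> lists S" for u
  proof -
    have "u \<in> ?c u" using u by (simp add: pres_cong_def pres_eq.refl)
    then have "(SOME v. v \<in> ?c u) \<in> ?c u" by (rule someI)
    then have "pres_eq S R u (SOME v. v \<in> ?c u)" by (simp add: pres_cong_def)
    then show ?thesis unfolding h_def using eq u pres_eq_lists by metis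
  qed
  have "h \<in> hom (presented_monoid S R) M"
  proof (rule homI)
    fix x y assume "x \<in> carrier (presented_monoid S R)" "y \<in> carrier (presented_monoid S R)"
    then obtain u v where "u \<in> lists S" "v \<in> lists S" "x = ?c u" "y = ?c v"
      unfolding car by auto
    then show "h (x \<otimes>\<^bsub>presented_monoid S R\<^esub> y) = h x \<otimes>\<^bsub>M\<^esub> h y"
      using h[of "u @ v"] by (simp add: h presented_monoid_mult mult)
  qed (use h closed in \<open>unfold car, force simp del: in_lists_conv_set\<close>)
  moreover have "h \<one>\<^bsub>presented_monoid S R\<^esub> = \<one>\<^bsub>M\<^esub>"
    using h[of "[]"] one by (simp add: presented_monoid_def)
  moreover have "inj_on h (carrier (presented_monoid S R))"
  proof (rule inj_onI)
    fix x y assume "x \<in> carrier (presented_monoid S R)" "y \<in> carrier (presented_monoid S R)" "h x = h y"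
    then obtain u v where uv: "u \<in> lists S" "v \<in> lists S" "x = ?c u" "y = ?c v"
      unfolding car by blast
    with \<open>h x = h y\<close> have "pres_eq S R u v" using h eq by metis
    with uv show "x = y"
      using equiv_class_eq[OF equiv_pres_cong] by (simp add: pres_cong_def)
  qed
  ultimately show ?thesis unfolding monoid_embedding_def by blast
qed

context trace_monoid begin

text \<open>The coordinate at \<open>p\<close> reads the projection to \<open>p\<close> as a binary word, the first letter of the pair
  being the bit \<open>True\<close>.\<close>

lemma embeds_in_affine_power:
  "\<exists>h. monoid_embedding (presented_monoid V rels) (product_group non_edges (\<lambda>_. affine_group)) h"
proof (rule presented_monoid_embedding)
  let ?bits = "\<lambda>p w. map (\<lambda>x. x = fst p) (proj p w)"
  let ?\<Phi> = "\<lambda>w. \<lambda>p\<in>non_edges. binary_affine (?bits p w)"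
  show "?\<Phi> [] = \<one>\<^bsub>product_group non_edges (\<lambda>_. affine_group)\<^esub>"
    by (auto simp: proj_def binary_affine_Nil)
  show "?\<Phi> (u @ v) = ?\<Phi> u \<otimes>\<^bsub>product_group non_edges (\<lambda>_. affine_group)\<^esub> ?\<Phi> v" for u v
    by (auto simp: proj_def binary_affine_append)
  fix u v assume uv: "u \<in> lists V" "v \<in> lists V"
  have bits: "?bits p u = ?bits p v \<longleftrightarrow> proj p u = proj p v" for p
  proof -
    have "inj_on (\<lambda>x. x = fst p) (set (proj p u) \<union> set (proj p v))"
      by (auto simp: proj_def inj_on_def)
    then show ?thesis by (rule inj_on_map_eq_map)
  qed
  have "?\<Phi> u = ?\<Phi> v \<longleftrightarrow> (\<forall>p\<in>non_edges. binary_affine (?bits p u) = binary_affine (?bits p v))"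
    by (auto simp: restrict_def fun_eq_iff)
  also have "\<dots> \<longleftrightarrow> (\<forall>p\<in>non_edges. proj p u = proj p v)"
    by (simp only: inj_eq[OF inj_binary_affine] bits)
  also have "\<dots> \<longleftrightarrow> pres_eq V rels u v"
    using eq_if_proj_eq uv proj_cong by blast
  finally show "?\<Phi> u = ?\<Phi> v \<longleftrightarrow> pres_eq V rels u v" .
qed (auto simp: PiE_iff extensional_def)

end

theorem theorem1:
  fixes \<Gamma> :: "'v pair_pre_digraph"
  assumes "pair_pseudo_graph \<Gamma>"
  shows "\<exists>(H :: nat monoid) h. amenable_group H \<and> monoid_embedding (raag_monoid \<Gamma>) H h"
proof -
  interpret \<Gamma>: pair_pseudo_graph \<Gamma> by (rule assms)
  interpret trace_monoid "pverts \<Gamma>" "parcs \<Gamma>"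
    by unfold_locales (auto intro: symI \<Gamma>.arcs_symmetric)
  let ?P = "product_group non_edges (\<lambda>_. affine_group)"
  obtain f where f: "monoid_embedding (raag_monoid \<Gamma>) ?P f"
    using embeds_in_affine_power unfolding raag_monoid_def by blast
  have "finite non_edges"
    by (rule finite_subset[of _ "pverts \<Gamma> \<times> pverts \<Gamma>"]) (auto simp: non_edges_def)
  then have "countable (carrier ?P)" by (auto intro: countable_PiE)
  then obtain H :: "nat monoid" and g where
    "group H" "solvable H" "monoid_embedding ?P H g"
    using countable_solvable_group_nat_copy[OF _ solvable_affine_power] group_affine_group
    by (metis product_group)
  then show ?thesis
    using group.solvable_imp_amenable monoid_embedding_trans[OF f] by blast
qed

end
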